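(* Let $\lambda \ge 0$ and let $m,n$ be positive integers. Let $\mathcal{D}=\mathcal{D}_\lambda$ be the map on $m\times n$ matrices defined as follows: if $\mathbf{X}=\mathbf{U}\mathbf{S}\mathbf{V}^*$ is a singular value decomposition of $\mathbf{X}$ with singular values $s_i$, then $\mathcal{D}_\lambda\mathbf{X}=\mathbf{U}\tilde{\mathbf{S}}\mathbf{V}^*$, where $\tilde{\mathbf{S}}$ is the diagonal matrix of the same size as $\mathbf{S}$ with diagonal entries $\tilde{s}_i=\min(s_i,\lambda)$. Then for all $m\times n$ matrices $\mathbf{X}$ and $\mathbf{Y}$ such that $\mathbf{Y}=\mathcal{D}\mathbf{Y}$, $$\langle \mathbf{X}-\mathbf{Y},\ \mathbf{X}-\mathcal{D}\mathbf{X}\rangle \ge 0 .$$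
   Context: Matrices are $m\times n$ with real or complex entries. $\langle \mathbf{A},\mathbf{B}\rangle=\operatorname{Re}\operatorname{trace}(\mathbf{A}^*\mathbf{B})$ is the (real) Frobenius inner product, where $^*$ denotes the conjugate transpose (the transpose for real matrices). In a singular value decomposition $\mathbf{X}=\mathbf{U}\mathbf{S}\mathbf{V}^*$, $\mathbf{U}$ and $\mathbf{V}$ are unitary (orthogonal in the real case) and $\mathbf{S}$ is an $m\times n$ (rectangular) diagonal matrix with nonnegative diagonal entries $s_i$, the singular values. The matrix $\mathcal{D}_\lambda\mathbf{X}$ does not depend on the choice of singular value decomposition. *)

theory Defs
  imports "HOL-Analysis.Analysis" "Jordan_Normal_Form.Schur_Decomposition"
begin

(* The sort {conjugatable_field, real_algebra_1} covers real and complex uniformly; on real,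
   conjugate is the identity, so mat_adjoint is the transpose and unitary means orthogonal. *)

definition mat_trace :: "'a :: comm_monoid_add mat \<Rightarrow> 'a" where
  "mat_trace A = (\<Sum>i < dim_row A. A $$ (i, i))"

definition frob_inner_real :: "real mat \<Rightarrow> real mat \<Rightarrow> real" where
  "frob_inner_real A B = mat_trace (mat_adjoint A * B)"

definition frob_inner_complex :: "complex mat \<Rightarrow> complex mat \<Rightarrow> real" where
  "frob_inner_complex A B = Re (mat_trace (mat_adjoint A * B))"

definition unitary_mat :: "nat \<Rightarrow> 'a :: conjugatable_field mat \<Rightarrow> bool" where
  "unitary_mat k U \<longleftrightarrow>
     U \<in> carrier_mat k k \<and> mat_adjoint U * U = 1\<^sub>m k \<and> U * mat_adjoint U = 1\<^sub>m k"

(* Only the values s i with i < min m n occur. *)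
definition rect_diag :: "nat \<Rightarrow> nat \<Rightarrow> (nat \<Rightarrow> real) \<Rightarrow> 'a :: real_algebra_1 mat" where
  "rect_diag m n s = mat m n (\<lambda>(i, j). if i = j then of_real (s i) else 0)"

definition is_svd ::
  "'a :: {conjugatable_field, real_algebra_1} mat \<Rightarrow> 'a mat \<Rightarrow> (nat \<Rightarrow> real) \<Rightarrow> 'a mat \<Rightarrow> bool" where
  "is_svd X U s V \<longleftrightarrow>
     unitary_mat (dim_row X) U \<and> unitary_mat (dim_col X) V \<and>
     (\<forall>i < min (dim_row X) (dim_col X). 0 \<le> s i) \<and>
     X = U * rect_diag (dim_row X) (dim_col X) s * mat_adjoint V"

(* The definite description is meaningful because every matrix has a singular value decomposition
   and the clipped matrix does not depend on which one is used. *)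
definition sv_clip ::
  "real \<Rightarrow> 'a :: {conjugatable_field, real_algebra_1} mat \<Rightarrow> 'a mat" where
  "sv_clip c X = (THE Z. \<exists>U s V. is_svd X U s V \<and>
     Z = U * rect_diag (dim_row X) (dim_col X) (\<lambda>i. min (s i) c) * mat_adjoint V)"

end

theory Submission
  imports Defs
begin

text \<open>
  Clipping the singular values of \<open>X\<close> at \<open>c\<close> is the orthogonal projection, in the Frobenius inner
  product, onto the convex set of matrices whose singular values are at most \<open>c\<close>, the ball of
  radius \<open>c\<close> in the spectral norm. A point \<open>Y\<close> that equals its own clipping lies in that ball. For
  every \<open>Y\<close> in the ball and \<open>Z\<close> the clipping of \<open>X\<close>, the projection inequality
  \<open>\<langle>Z - Y, X - Z\<rangle> \<ge> 0\<close> holds, and adding \<open>\<langle>X - Z, X - Z\<rangle> \<ge> 0\<close> gives the theorem.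

  The projection inequality (\<open>frob_clip_nonneg\<close>) is a computation in the singular bases
  of \<open>X = U S V\<^sup>*\<close>. By unitary invariance \<open>\<langle>Z - Y, X - Z\<rangle>\<close> equals
  \<open>\<Sum>\<^sub>i (min s\<^sub>i c - Re W\<^sub>i\<^sub>i) (s\<^sub>i - min s\<^sub>i c)\<close> with \<open>W = U\<^sup>* Y V\<close>; the second factor is nonzero
  only when \<open>min s\<^sub>i c = c\<close>, and \<open>Re W\<^sub>i\<^sub>i \<le> c\<close> because \<open>W\<close> lies in the ball
  (\<open>re_part_diag_entry_le\<close>).

  Since the clipping is given by a definite description, both uniqueness and existence have to be
  established. Uniqueness (\<open>sv_clip_eqI\<close>) is again the projection inequality: if \<open>Z\<close> and \<open>Z'\<close> are
  clippings of \<open>X\<close> from two decompositions, then \<open>\<langle>Z - Z', X - Z\<rangle> \<ge> 0\<close> and \<open>\<langle>Z' - Z, X - Z'\<rangle> \<ge> 0\<close>,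
  whose sum is \<open>- \<langle>Z - Z', Z - Z'\<rangle>\<close>. Existence of a singular value decomposition (\<open>svd_exists\<close>)
  goes by induction on the number of rows: a unit vector \<open>v\<close> maximising the norm of \<open>X v\<close> exists by
  compactness, and in orthonormal bases that start with \<open>v\<close> and with the direction of \<open>X v\<close> the
  matrix is block diagonal with a scalar first block (\<open>split_off_singular_value\<close>).
\<close>

section \<open>Real and complex scalars\<close>

text \<open>
  The common ground of the two scalar fields: the conjugation is tied to the norm, spheres are compact
  (\<open>heine_borel\<close>), and the order on the field is the one that makes Gram-Schmidt applicable.
\<close>

class real_or_complex = conjugatable_ordered_field + real_normed_field + heine_borel +
  assumes mult_conjugate_scaleR: "x * conjugate x = (norm x)\<^sup>2 *\<^sub>R 1"

instance real :: real_or_complex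
  by standard (simp add: power2_eq_square)

instance complex :: real_or_complex
  by standard (simp add: complex_norm_square[symmetric] scaleR_conv_of_real)

lemma mult_conjugate: "x * conjugate x = of_real ((norm (x :: 'a :: real_or_complex))\<^sup>2)"
  by (simp only: mult_conjugate_scaleR of_real_def)

text \<open>
  The real part expressed through the norm by polarisation, so that one formula serves both fields.
\<close>

definition re_part :: "'a :: real_or_complex \<Rightarrow> real" where
  "re_part x = ((norm (x + 1))\<^sup>2 - (norm x)\<^sup>2 - 1) / 2"

lemma re_part_real: "re_part (x :: real) = x"
  by (simp add: re_part_def power2_eq_square field_simps)

lemma re_part_complex: "re_part (z :: complex) = Re z"
  by (simp add: re_part_def cmod_power2) (simp add: power2_eq_square field_simps)

lemma conjugate_of_real [simp]: "conjugate (of_real r) = (of_real r :: 'a :: real_or_complex)"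
proof (cases "r = 0")
  case False
  have "of_real r * conjugate (of_real r :: 'a) = of_real r * of_real r"
    by (simp add: mult_conjugate power2_eq_square)
  with False show ?thesis by simp
qed simp

lemma conjugate_one [simp]: "conjugate 1 = (1 :: 'a :: real_or_complex)"
  using conjugate_of_real[of 1] by simp

lemma norm_conjugate [simp]: "norm (conjugate x) = norm (x :: 'a :: real_or_complex)"
proof -
  have "of_real ((norm (conjugate x))\<^sup>2) = (of_real ((norm x)\<^sup>2) :: 'a)"
    by (metis mult_conjugate conjugate_id mult.commute)
  then have "(norm (conjugate x))\<^sup>2 = (norm x)\<^sup>2" by (simp only: of_real_eq_iff)
  then show ?thesis by simp
qed

lemma conjugate_diff: "conjugate (x - y) = conjugate x - conjugate (y :: 'a :: real_or_complex)"
  using conjugate_dist_add[of x "- y"] by (simp add: conjugate_neg)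

lemma of_real_re_part: "of_real (2 * re_part x) = x + conjugate (x :: 'a :: real_or_complex)"
proof -
  have "of_real (2 * re_part x) = of_real ((norm (x + 1))\<^sup>2) - of_real ((norm x)\<^sup>2) - (1::'a)"
    by (simp add: re_part_def)
  also have "\<dots> = (x + 1) * conjugate (x + 1) - x * conjugate x - 1"
    by (simp only: mult_conjugate)
  also have "\<dots> = x + conjugate x"
    by (simp add: conjugate_dist_add algebra_simps)
  finally show ?thesis .
qed

lemma re_part_eqI:
  "x + conjugate x = of_real (2 * r) \<Longrightarrow> re_part (x :: 'a :: real_or_complex) = r"
  using of_real_re_part[of x] of_real_eq_iff[of "2 * re_part x" "2 * r", where 'a = 'a] by simp

lemma re_part_of_real_mult [simp]:
  "re_part (of_real r * x) = r * re_part (x :: 'a :: real_or_complex)"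
proof (rule re_part_eqI)
  have "of_real r * x + conjugate (of_real r * x) = of_real r * (x + conjugate x)"
    by (simp add: conjugate_dist_mul algebra_simps)
  also have "\<dots> = of_real (2 * (r * re_part x))"
    by (simp add: of_real_re_part[symmetric] algebra_simps)
  finally show "of_real r * x + conjugate (of_real r * x) = of_real (2 * (r * re_part x))" .
qed

lemma re_part_add [simp]: "re_part (x + y) = re_part x + re_part (y :: 'a :: real_or_complex)"
proof (rule re_part_eqI)
  have "x + y + conjugate (x + y) = (x + conjugate x) + (y + conjugate y)"
    by (simp add: conjugate_dist_add algebra_simps)
  also have "\<dots> = of_real (2 * (re_part x + re_part y))"
    by (simp add: of_real_re_part[symmetric] algebra_simps)
  finally show "x + y + conjugate (x + y) = of_real (2 * (re_part x + re_part y))" .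
qed

lemma re_part_of_real [simp]: "re_part (of_real r :: 'a :: real_or_complex) = r"
  by (rule re_part_eqI) simp

lemma re_part_0 [simp]: "re_part (0 :: 'a :: real_or_complex) = 0"
  using re_part_of_real[of 0] by simp

lemma re_part_minus [simp]: "re_part (- x) = - re_part (x :: 'a :: real_or_complex)"
  using re_part_of_real_mult[of "-1" x] by simp

lemma re_part_diff [simp]: "re_part (x - y) = re_part x - re_part (y :: 'a :: real_or_complex)"
  using re_part_add[of x "- y"] by simp

lemma re_part_sum: "re_part (sum f A) = (\<Sum>a\<in>A. re_part (f a :: 'a :: real_or_complex))"
  by (induction A rule: infinite_finite_induct) auto

lemma re_part_conjugate_mult [simp]:
  "re_part (conjugate x * x) = (norm (x :: 'a :: real_or_complex))\<^sup>2"
  by (metis mult_conjugate mult.commute re_part_of_real)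

lemma re_part_conjugate [simp]: "re_part (conjugate x) = re_part (x :: 'a :: real_or_complex)"
  by (rule re_part_eqI) (simp only: conjugate_id of_real_re_part add.commute)

text \<open>
  With the polarised real part this is just the triangle inequality for \<open>x + 1\<close>.
\<close>

lemma re_part_le_norm: "re_part x \<le> norm (x :: 'a :: real_or_complex)"
proof -
  have "(norm (x + 1))\<^sup>2 \<le> (norm x + 1)\<^sup>2"
    using norm_triangle_ineq[of x 1] by (intro power_mono) auto
  then show ?thesis
    by (simp add: re_part_def power2_eq_square algebra_simps)
qed

section \<open>Adjoints and the Frobenius inner product\<close>

lemma index_mat_adjoint [simp]:
  "i < dim_col A \<Longrightarrow> j < dim_row A \<Longrightarrow> mat_adjoint A $$ (i, j) = conjugate (A $$ (j, i))"
  by (simp add: mat_adjoint_def mat_of_rows_def)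

lemma dim_mat_adjoint [simp]:
  "dim_row (mat_adjoint A) = dim_col A" "dim_col (mat_adjoint A) = dim_row A"
  by (simp_all add: mat_adjoint_def)

lemma mat_adjoint_carrier [simp]: "A \<in> carrier_mat m n \<Longrightarrow> mat_adjoint A \<in> carrier_mat n m"
  by (auto intro: carrier_matI)

lemma mat_adjoint_adjoint [simp]: "mat_adjoint (mat_adjoint A) = A"
  by (rule eq_matI) auto

lemma index_mult_mat_sum:
  assumes "A \<in> carrier_mat m k" "B \<in> carrier_mat k n" "i < m" "j < n"
  shows "(A * B) $$ (i, j) = (\<Sum>l<k. A $$ (i, l) * B $$ (l, j))"
  using assms by (auto simp: scalar_prod_def atLeast0LessThan intro!: sum.cong)

lemma mat_adjoint_mult:
  assumes A: "A \<in> carrier_mat m k" and B: "B \<in> carrier_mat k n"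
  shows "mat_adjoint (A * B) = mat_adjoint B * mat_adjoint A"
proof (rule eq_matI)
  fix i j assume "i < dim_row (mat_adjoint B * mat_adjoint A)"
    and "j < dim_col (mat_adjoint B * mat_adjoint A)"
  then have i: "i < n" and j: "j < m" using A B by auto
  have "mat_adjoint (A * B) $$ (i, j) = conjugate ((A * B) $$ (j, i))"
    using A B i j by (intro index_mat_adjoint) auto
  also have "\<dots> = (\<Sum>l<k. conjugate (A $$ (j, l) * B $$ (l, i)))"
    by (simp only: index_mult_mat_sum[OF A B j i] sum_conjugate finite_lessThan)
  also have "\<dots> = (\<Sum>l<k. mat_adjoint B $$ (i, l) * mat_adjoint A $$ (l, j))"
    using A B i j by (intro sum.cong) (auto simp: conjugate_dist_mul mult.commute)
  also have "\<dots> = (mat_adjoint B * mat_adjoint A) $$ (i, j)"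
    using index_mult_mat_sum[OF mat_adjoint_carrier[OF B] mat_adjoint_carrier[OF A] i j] ..
  finally show "mat_adjoint (A * B) $$ (i, j) = (mat_adjoint B * mat_adjoint A) $$ (i, j)" .
qed (use A B in auto)

definition frob :: "'a :: real_or_complex mat \<Rightarrow> 'a mat \<Rightarrow> real" where
  "frob A B = re_part (mat_trace (mat_adjoint A * B))"

lemma frob_inner_real_eq: "frob_inner_real = frob"
  by (intro ext) (simp add: frob_inner_real_def frob_def re_part_real)

lemma frob_inner_complex_eq: "frob_inner_complex = frob"
  by (intro ext) (simp add: frob_inner_complex_def frob_def re_part_complex)

lemma frob_eq_sum:
  assumes A: "A \<in> carrier_mat m n" and B: "B \<in> carrier_mat m n"
  shows "frob A B = (\<Sum>j<n. \<Sum>i<m. re_part (conjugate (A $$ (i, j)) * B $$ (i, j)))"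
proof -
  have "mat_trace (mat_adjoint A * B) = (\<Sum>j<n. \<Sum>i<m. conjugate (A $$ (i, j)) * B $$ (i, j))"
    using A B unfolding mat_trace_def
    by (intro sum.cong)
      (auto simp del: index_mult_mat(1) simp: index_mult_mat_sum[OF mat_adjoint_carrier[OF A] B])
  then show ?thesis by (simp add: frob_def re_part_sum)
qed

lemma frob_self:
  assumes A: "A \<in> carrier_mat m n"
  shows "frob A A = (\<Sum>j<n. \<Sum>i<m. (norm (A $$ (i, j)))\<^sup>2)"
  by (simp add: frob_eq_sum[OF A A])

lemma frob_self_nonneg: "0 \<le> frob A A"
  by (subst frob_self[OF carrier_matI[OF refl refl]]) (intro sum_nonneg, auto)

lemma frob_self_eq_0D:
  assumes A: "A \<in> carrier_mat m n" and 0: "frob A A = 0"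
  shows "A = 0\<^sub>m m n"
proof (rule eq_matI)
  fix i j assume ij: "i < dim_row (0\<^sub>m m n)" "j < dim_col (0\<^sub>m m n)"
  have "(\<Sum>i<m. (norm (A $$ (i, j)))\<^sup>2) = 0"
    using 0 ij unfolding frob_self[OF A] by (subst (asm) sum_nonneg_eq_0_iff) (auto intro: sum_nonneg)
  then show "A $$ (i, j) = 0\<^sub>m m n $$ (i, j)"
    using ij by (subst (asm) sum_nonneg_eq_0_iff) auto
qed (use A in auto)

lemma frob_diff_left:
  assumes A: "A \<in> carrier_mat m n" and B: "B \<in> carrier_mat m n" and C: "C \<in> carrier_mat m n"
  shows "frob (A - B) C = frob A C - frob B C"
  unfolding frob_eq_sum[OF A C] frob_eq_sum[OF B C] frob_eq_sum[OF minus_carrier_mat[OF B] C]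
  using A B by (simp add: sum_subtractf[symmetric] left_diff_distrib conjugate_diff)

lemma frob_diff_right:
  assumes A: "A \<in> carrier_mat m n" and B: "B \<in> carrier_mat m n" and C: "C \<in> carrier_mat m n"
  shows "frob C (A - B) = frob C A - frob C B"
  unfolding frob_eq_sum[OF C A] frob_eq_sum[OF C B] frob_eq_sum[OF C minus_carrier_mat[OF B]]
  using A B by (simp add: sum_subtractf[symmetric] right_diff_distrib)

lemma frob_self_column:
  assumes "v \<in> carrier_mat n 1"
  shows "frob v v = (\<Sum>i<n. (norm (v $$ (i, 0)))\<^sup>2)"
  by (simp add: frob_self[OF assms])

lemma frob_smult_self: "frob (of_real r \<cdot>\<^sub>m A) (of_real r \<cdot>\<^sub>m A) = r\<^sup>2 * frob A (A :: 'a :: real_or_complex mat)"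
proof -
  have A: "A \<in> carrier_mat (dim_row A) (dim_col A)" by simp
  show ?thesis
    unfolding frob_self[OF A] frob_self[OF smult_carrier_mat[OF A]]
    by (simp add: norm_mult power_mult_distrib sum_distrib_left)
qed

section \<open>Unitary matrices\<close>

lemma unitary_matD:
  assumes "unitary_mat k U"
  shows "U \<in> carrier_mat k k" "mat_adjoint U * U = 1\<^sub>m k" "U * mat_adjoint U = 1\<^sub>m k"
  using assms by (auto simp: unitary_mat_def)

lemma unitary_mat_adjoint: "unitary_mat k U \<Longrightarrow> unitary_mat k (mat_adjoint U)"
  by (simp add: unitary_mat_def)

lemma unitary_mat_adjoint_cancel:
  assumes U: "unitary_mat k U" and A: "A \<in> carrier_mat k n"
  shows "mat_adjoint U * (U * A) = A" "U * (mat_adjoint U * A) = A"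
proof -
  note u = unitary_matD[OF U]
  show "mat_adjoint U * (U * A) = A"
    using assoc_mult_mat[OF mat_adjoint_carrier[OF u(1)] u(1) A] u(2) A by simp
  show "U * (mat_adjoint U * A) = A"
    using assoc_mult_mat[OF u(1) mat_adjoint_carrier[OF u(1)] A] u(3) A by simp
qed

lemma unitary_mat_mult:
  assumes U: "unitary_mat k U" and V: "unitary_mat k V"
  shows "unitary_mat k (U * V)"
proof -
  note u = unitary_matD[OF U] and v = unitary_matD[OF V]
  note [simp] = u(1) v(1) mat_adjoint_mult[OF u(1) v(1)]
  have "mat_adjoint V * mat_adjoint U * (U * V) = mat_adjoint V * (mat_adjoint U * (U * V))"
    by (rule assoc_mult_mat[where n\<^sub>1 = k and n\<^sub>2 = k and n\<^sub>3 = k and n\<^sub>4 = k])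
      (auto intro: mult_carrier_mat[where n = k])
  moreover have "U * V * (mat_adjoint V * mat_adjoint U) = U * (V * (mat_adjoint V * mat_adjoint U))"
    by (rule assoc_mult_mat[where n\<^sub>1 = k and n\<^sub>2 = k and n\<^sub>3 = k and n\<^sub>4 = k])
      (auto intro: mult_carrier_mat[where n = k])
  ultimately have "mat_adjoint (U * V) * (U * V) = 1\<^sub>m k" "U * V * mat_adjoint (U * V) = 1\<^sub>m k"
    using u v by (simp_all add: unitary_mat_adjoint_cancel[OF U, of _ k] unitary_mat_adjoint_cancel[OF V, of _ k])
  then show ?thesis
    unfolding unitary_mat_def using mult_carrier_mat[OF u(1) v(1)] by blast
qed

lemma frob_unitary_left:
  assumes U: "unitary_mat m U" and A: "A \<in> carrier_mat m n" and B: "B \<in> carrier_mat m n"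
  shows "frob (U * A) (U * B) = frob A B"
proof -
  note u = unitary_matD[OF U]
  have "mat_adjoint (U * A) * (U * B) = mat_adjoint A * (mat_adjoint U * (U * B))"
    unfolding mat_adjoint_mult[OF u(1) A]
    using u(1) A B by (intro assoc_mult_mat) auto
  then show ?thesis by (simp add: frob_def unitary_mat_adjoint_cancel[OF U B])
qed

lemma frob_adjoint:
  assumes A: "A \<in> carrier_mat m n" and B: "B \<in> carrier_mat m n"
  shows "frob (mat_adjoint A) (mat_adjoint B) = frob A B"
  unfolding frob_eq_sum[OF A B] frob_eq_sum[OF mat_adjoint_carrier[OF A] mat_adjoint_carrier[OF B]]
proof (subst sum.swap, intro sum.cong refl)
  fix i j assume ij: "j \<in> {..<n}" "i \<in> {..<m}"
  have "re_part (A $$ (i, j) * conjugate (B $$ (i, j)))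
      = re_part (conjugate (conjugate (A $$ (i, j)) * B $$ (i, j)))"
    by (simp only: conjugate_dist_mul conjugate_id)
  then show "re_part (conjugate (mat_adjoint A $$ (j, i)) * mat_adjoint B $$ (j, i))
      = re_part (conjugate (A $$ (i, j)) * B $$ (i, j))"
    using A B ij by simp
qed

lemma frob_unitary_right:
  assumes V: "unitary_mat n V" and A: "A \<in> carrier_mat m n" and B: "B \<in> carrier_mat m n"
  shows "frob (A * mat_adjoint V) (B * mat_adjoint V) = frob A B"
proof -
  note v = unitary_matD(1)[OF V]
  have adj: "C * mat_adjoint V = mat_adjoint (V * mat_adjoint C)" if "C \<in> carrier_mat m n" for C
    using mat_adjoint_mult[OF v mat_adjoint_carrier[OF that]] by simp
  have "frob (A * mat_adjoint V) (B * mat_adjoint V) = frob (V * mat_adjoint A) (V * mat_adjoint B)"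
    unfolding adj[OF A] adj[OF B] using v A B by (intro frob_adjoint[of _ n m]) auto
  also have "\<dots> = frob A B"
    by (simp add: frob_unitary_left[OF V mat_adjoint_carrier[OF A] mat_adjoint_carrier[OF B]]
        frob_adjoint[OF A B])
  finally show ?thesis .
qed

lemma mat_adjoint_one [simp]: "mat_adjoint (1\<^sub>m n) = (1\<^sub>m n :: 'a :: real_or_complex mat)"
  by (rule eq_matI) auto

lemma unitary_mat_1: "unitary_mat n (1\<^sub>m n :: 'a :: real_or_complex mat)"
  by (simp add: unitary_mat_def)

lemma sum_norm_row_unitary:
  fixes P :: "'a :: real_or_complex mat"
  assumes P: "unitary_mat k P" and i: "i < k"
  shows "(\<Sum>l<k. (norm (P $$ (i, l)))\<^sup>2) = 1"
proof -
  note p = unitary_matD[OF P]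
  have "(1 :: 'a) = (P * mat_adjoint P) $$ (i, i)"
    using i by (simp add: p)
  also have "\<dots> = (\<Sum>l<k. P $$ (i, l) * mat_adjoint P $$ (l, i))"
    by (rule index_mult_mat_sum[OF p(1) mat_adjoint_carrier[OF p(1)] i i])
  also have "\<dots> = (\<Sum>l<k. P $$ (i, l) * conjugate (P $$ (i, l)))"
    using p(1) i by (intro sum.cong) auto
  also have "\<dots> = of_real (\<Sum>l<k. (norm (P $$ (i, l)))\<^sup>2)"
    by (simp only: mult_conjugate of_real_sum)
  finally show ?thesis
    using of_real_eq_iff[of 1 "\<Sum>l<k. (norm (P $$ (i, l)))\<^sup>2", where 'a = 'a] by simp
qed

section \<open>Existence of singular value decompositions\<close>

text \<open>
  Gram-Schmidt on a basis that starts with the given vector yields orthogonal columns; these are then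
  normalised. The first column is already a unit vector, so normalisation does not change it.
\<close>

lemma extend_unit_column:
  fixes v :: "'a :: real_or_complex mat"
  assumes v: "v \<in> carrier_mat n 1" and v1: "frob v v = 1"
  obtains V where "unitary_mat n V" "\<And>i. i < n \<Longrightarrow> V $$ (i, 0) = v $$ (i, 0)"
proof -
  interpret cof_vec_space n "TYPE('a)" .
  have n: "0 < n" using v1 by (cases n) (simp_all add: frob_self_column[OF v])
  define w where "w = col v 0"
  have w: "w \<in> carrier_vec n" using v by (auto simp: w_def)
  have w0: "w \<noteq> 0\<^sub>v n"
  proof
    assume w0: "w = 0\<^sub>v n"
    have "v $$ (i, 0) = 0" if "i < n" for i
      using arg_cong[OF w0, of "\<lambda>x. vec_index x i"] that v by (simp add: w_def)
    then show False using v1 by (simp add: frob_self_column[OF v])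
  qed
  define b where "b = basis_completion w"
  define ws where "ws = gram_schmidt n b"
  note bc = basis_completion[OF w w0, folded b_def]
  obtain bs where b: "b = w # bs" using bc n by (cases b) auto
  have ws: "set ws \<subseteq> carrier_vec n" "corthogonal ws" "length ws = n"
    using gram_schmidt_result[OF bc(2,4,5) refl, folded ws_def] bc by auto
  have hd: "hd ws = w"
    unfolding ws_def b by (rule gram_schmidt_hd[OF w])
  then have ws0: "ws ! 0 = w" using ws(3) n by (cases ws) auto
  define N where "N j = (\<Sum>i<n. (norm (vec_index (ws ! j) i))\<^sup>2)" for j
  have sprod: "(\<Sum>i<n. conjugate (vec_index (ws ! j) i) * vec_index (ws ! k) i)
      = (if j = k then of_real (N j) else 0)" if "j < n" "k < n" for j k
  proof (cases "j = k")
    case True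
    have "conjugate x * x = of_real ((norm x)\<^sup>2)" for x :: 'a
      by (metis mult_conjugate mult.commute)
    then show ?thesis using True by (simp add: N_def)
  next
    case False
    have c: "ws ! j \<in> carrier_vec n" "ws ! k \<in> carrier_vec n" using ws that by auto
    have "ws ! k \<bullet>c ws ! j = 0" using corthogonalD[OF ws(2), of k j] that ws(3) False by auto
    then show ?thesis using False c
      by (simp add: scalar_prod_def atLeast0LessThan mult.commute)
  qed
  have N: "N j > 0" if "j < n" for j
  proof -
    have "ws ! j \<bullet>c ws ! j \<noteq> 0" using corthogonalD[OF ws(2), of j j] that ws(3) by auto
    moreover have "ws ! j \<in> carrier_vec n" using ws that by auto
    ultimately have "(\<Sum>i<n. conjugate (vec_index (ws ! j) i) * vec_index (ws ! j) i) \<noteq> 0"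
      by (simp add: scalar_prod_def atLeast0LessThan mult.commute)
    then have "N j \<noteq> 0" using sprod[OF that that] by auto
    moreover have "N j \<ge> 0" by (auto simp: N_def intro: sum_nonneg)
    ultimately show ?thesis by simp
  qed
  have N0: "N 0 = 1"
    using v v1 by (simp add: N_def ws0 frob_self_column[OF v] w_def)
  define V where "V = mat n n (\<lambda>(i, j). of_real (1 / sqrt (N j)) * vec_index (ws ! j) i)"
  have V: "V \<in> carrier_mat n n" by (simp add: V_def)
  have VV: "mat_adjoint V * V = 1\<^sub>m n"
  proof (rule eq_matI)
    fix j k assume "j < dim_row (1\<^sub>m n)" "k < dim_col (1\<^sub>m n)"
    then have jk: "j < n" "k < n" by auto
    have "(mat_adjoint V * V) $$ (j, k) = (\<Sum>i<n. mat_adjoint V $$ (j, i) * V $$ (i, k))"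
      by (rule index_mult_mat_sum[OF mat_adjoint_carrier[OF V] V jk])
    also have "\<dots> = (\<Sum>i<n. of_real (1 / sqrt (N j)) * of_real (1 / sqrt (N k)) *
        (conjugate (vec_index (ws ! j) i) * vec_index (ws ! k) i))"
      using jk V by (intro sum.cong) (auto simp: V_def conjugate_dist_mul ac_simps simp del: of_real_divide)
    also have "\<dots> = of_real (1 / sqrt (N j)) * of_real (1 / sqrt (N k)) * (if j = k then of_real (N j) else 0)"
      by (simp only: sum_distrib_left[symmetric] sprod[OF jk])
    also have "\<dots> = 1\<^sub>m n $$ (j, k)"
      using jk N[OF jk(1)] by (auto simp flip: of_real_mult)
    finally show "(mat_adjoint V * V) $$ (j, k) = 1\<^sub>m n $$ (j, k)" .
  qed (use V in auto)
  have "unitary_mat n V"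
    unfolding unitary_mat_def
    using V VV mat_mult_left_right_inverse[OF mat_adjoint_carrier[OF V] V VV] by blast
  moreover have "V $$ (i, 0) = v $$ (i, 0)" if "i < n" for i
    using that n v by (simp add: V_def N0 ws0 w_def)
  ultimately show ?thesis using that by blast
qed

text \<open>
  The functions \<open>nat \<Rightarrow> 'a\<close> with the product topology host vectors of every length at once. There the
  unit sphere of dimension \<open>n\<close> is a closed subset of a product of balls and points, hence compact by
  Tychonoff's theorem.
\<close>

lemma compact_unit_sphere_finitely_supported:
  "compact {f :: nat \<Rightarrow> 'a :: real_or_complex. (\<forall>i\<ge>n. f i = 0) \<and> (\<Sum>i<n. (norm (f i))\<^sup>2) = 1}"
    (is "compact ?S")
proof -
  let ?B = "\<lambda>i. if i < n then cball (0 :: 'a) 1 else {0}"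
  have "compact (PiE UNIV ?B)"
    using compactin_PiE[of "\<lambda>_. euclidean" UNIV ?B]
    by (simp add: euclidean_product_topology)
  moreover have "closed {f :: nat \<Rightarrow> 'a. (\<Sum>i<n. (norm (f i))\<^sup>2) = 1}"
    by (intro closed_Collect_eq continuous_intros continuous_on_product_coordinates)
  ultimately have "compact (PiE UNIV ?B \<inter> {f. (\<Sum>i<n. (norm (f i))\<^sup>2) = 1})"
    by (rule compact_Int_closed)
  moreover have "?S = PiE UNIV ?B \<inter> {f. (\<Sum>i<n. (norm (f i))\<^sup>2) = 1}"
  proof (rule Set.set_eqI)
    fix f :: "nat \<Rightarrow> 'a"
    have "norm (f i) \<le> 1" if "(\<Sum>i<n. (norm (f i))\<^sup>2) = 1" "i < n" for i
    proof -
      have "(norm (f i))\<^sup>2 \<le> (\<Sum>i<n. (norm (f i))\<^sup>2)"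
        using that(2) by (intro member_le_sum) auto
      then show ?thesis using that(1) abs_le_square_iff[of "norm (f i)" 1] by simp
    qed
    then show "f \<in> ?S \<longleftrightarrow> f \<in> PiE UNIV ?B \<inter> {f. (\<Sum>i<n. (norm (f i))\<^sup>2) = 1}"
      by (auto simp: PiE_iff not_less)
  qed
  ultimately show ?thesis by simp
qed

text \<open>
  By compactness the operator norm of \<open>X\<close> is attained. Vectors are matrices with one column, so that
  the unitary invariance of \<open>frob\<close> applies to them directly.
\<close>

lemma maximal_unit_column:
  fixes X :: "'a :: real_or_complex mat"
  assumes X: "X \<in> carrier_mat m n" and n: "0 < n"
  obtains v where "v \<in> carrier_mat n 1" "frob v v = 1"
    "\<And>w. w \<in> carrier_mat n 1 \<Longrightarrow> frob (X * w) (X * w) \<le> frob (X * v) (X * v) * frob w w"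
proof -
  define S where "S = {f :: nat \<Rightarrow> 'a. (\<forall>i\<ge>n. f i = 0) \<and> (\<Sum>i<n. (norm (f i))\<^sup>2) = 1}"
  define g where "g f = (\<Sum>i<m. (norm (\<Sum>j<n. X $$ (i, j) * f j))\<^sup>2)" for f :: "nat \<Rightarrow> 'a"
  have g: "frob (X * w) (X * w) = g f"
    if "w \<in> carrier_mat n 1" "\<And>j. j < n \<Longrightarrow> w $$ (j, 0) = f j" for w f
    unfolding frob_self_column[OF mult_carrier_mat[OF X that(1)]] g_def
    using that by (intro sum.cong) (auto simp: index_mult_mat_sum[OF X that(1)] simp del: index_mult_mat(1))
  have "S \<noteq> {}"
  proof
    assume empty: "S = {}"
    have "(\<Sum>i<n. (norm (if i = 0 then 1 else 0 :: 'a))\<^sup>2) = (\<Sum>i<n. if i = 0 then 1 else 0)"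
      by (intro sum.cong) auto
    then have "(\<lambda>i. if i = 0 then 1 else 0) \<in> S" using n by (simp add: S_def)
    then show False unfolding empty by (rule emptyE)
  qed
  moreover have "continuous_on S g"
  proof -
    have coord: "continuous_on S (\<lambda>f. f j)" for j
      by (rule continuous_on_subset[OF continuous_on_product_coordinates]) simp
    show ?thesis
      unfolding g_def
      by (intro continuous_on_sum continuous_on_power continuous_on_norm
          continuous_on_mult continuous_on_const coord)
  qed
  moreover have "compact S"
    unfolding S_def by (rule compact_unit_sphere_finitely_supported)
  ultimately have "\<exists>f\<in>S. \<forall>h\<in>S. g h \<le> g f" by (intro continuous_attains_sup)
  then obtain f where f: "f \<in> S" and max: "\<And>h. h \<in> S \<Longrightarrow> g h \<le> g f"
    by (elim bexE) (simp only: Ball_def)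
  define v where "v = mat n 1 (\<lambda>(i, _). f i)"
  have v: "v \<in> carrier_mat n 1" by (simp add: v_def)
  have v1: "frob v v = 1" unfolding frob_self_column[OF v] using f by (simp add: v_def S_def)
  have Xv: "frob (X * v) (X * v) = g f" by (rule g[OF v]) (simp add: v_def)
  have unit: "frob (X * w) (X * w) \<le> g f" if w: "w \<in> carrier_mat n 1" and "frob w w = 1" for w
  proof -
    let ?h = "\<lambda>i. if i < n then w $$ (i, 0) else 0"
    have "?h \<in> S" using that by (simp add: frob_self_column[OF w] S_def)
    moreover have "frob (X * w) (X * w) = g ?h" by (rule g[OF w]) simp
    ultimately show ?thesis using max by simp
  qed
  have "frob (X * w) (X * w) \<le> g f * frob w w" if w: "w \<in> carrier_mat n 1" for w
  proof (cases "frob w w = 0")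
    case True
    then have "w = 0\<^sub>m n 1" by (rule frob_self_eq_0D[OF w])
    then have "X * w = 0\<^sub>m m 1" using X by simp
    then show ?thesis using True by (simp add: frob_self[of _ m 1])
  next
    case False
    define r where "r = sqrt (frob w w)"
    have r: "r > 0" "r\<^sup>2 = frob w w" using False frob_self_nonneg[of w] by (auto simp: r_def)
    let ?w = "of_real (1 / r) \<cdot>\<^sub>m w"
    have "frob ?w ?w = 1"
      unfolding frob_smult_self r(2)[symmetric] using r(1) by (simp add: power_divide)
    then have "frob (X * ?w) (X * ?w) \<le> g f"
      using w by (intro unit) auto
    moreover have "X * ?w = of_real (1 / r) \<cdot>\<^sub>m (X * w)"
      using X w by (rule mult_smult_distrib)
    ultimately have "(1 / r)\<^sup>2 * frob (X * w) (X * w) \<le> g f"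
      by (simp only: frob_smult_self)
    then have "frob (X * w) (X * w) / frob w w \<le> g f"
      unfolding r(2)[symmetric] by (simp add: power_divide)
    moreover have "0 < frob w w" using False frob_self_nonneg[of w] by simp
    ultimately show ?thesis by (simp add: pos_divide_le_eq)
  qed
  then show ?thesis using that v v1 Xv by metis
qed

lemma rect_diag_carrier [simp]: "rect_diag m n s \<in> carrier_mat m n"
  by (simp add: rect_diag_def)

lemma index_rect_diag [simp]:
  "i < m \<Longrightarrow> j < n \<Longrightarrow> rect_diag m n s $$ (i, j) = (if i = j then of_real (s i) else 0)"
  by (simp add: rect_diag_def)

text \<open>
  Let \<open>\<sigma>\<close> be the operator norm of \<open>X\<close>, attained at \<open>v\<close>, and \<open>u = X v / \<sigma>\<close>. In unitary bases starting
  with \<open>u\<close> and \<open>v\<close> the first column of \<open>X\<close> is \<open>(\<sigma>, 0, ..., 0)\<close>. If its first row were longer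
  than \<open>\<sigma>\<close>, applying the matrix to the conjugate of that row would stretch it by more than \<open>\<sigma>\<close>; hence
  the rest of the row vanishes too.
\<close>

lemma split_off_singular_value:
  fixes X :: "'a :: real_or_complex mat"
  assumes X: "X \<in> carrier_mat (Suc m) (Suc n)" and X0: "X \<noteq> 0\<^sub>m (Suc m) (Suc n)"
  obtains U V \<sigma> B where "unitary_mat (Suc m) U" "unitary_mat (Suc n) V" "0 \<le> \<sigma>"
    "B \<in> carrier_mat m n"
    "X = U * four_block_mat (mat 1 1 (\<lambda>_. of_real \<sigma>)) (0\<^sub>m 1 n) (0\<^sub>m m 1) B * mat_adjoint V"
proof -
  obtain v where v: "v \<in> carrier_mat (Suc n) 1" and v1: "frob v v = 1"
    and max: "\<And>w. w \<in> carrier_mat (Suc n) 1 \<Longrightarrow> frob (X * w) (X * w) \<le> frob (X * v) (X * v) * frob w w"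
    using maximal_unit_column[OF X] by blast
  have Xv: "X * v \<in> carrier_mat (Suc m) 1" using X v by auto
  define \<sigma> where "\<sigma> = sqrt (frob (X * v) (X * v))"
  have "\<sigma> \<noteq> 0"
  proof
    assume "\<sigma> = 0"
    then have Xw: "X * w = 0\<^sub>m (Suc m) 1" if "w \<in> carrier_mat (Suc n) 1" for w
      using max[OF that] frob_self_nonneg[of "X * w"] that X
      by (intro frob_self_eq_0D) (auto simp: \<sigma>_def)
    have "X = 0\<^sub>m (Suc m) (Suc n)"
    proof (rule eq_matI)
      fix i j assume "i < dim_row (0\<^sub>m (Suc m) (Suc n))" "j < dim_col (0\<^sub>m (Suc m) (Suc n))"
      then have ij: "i < Suc m" "j < Suc n" by auto
      \<comment> \<open>A maximum of zero kills all unit vectors, in particular those that pick out the columns of \<open>X\<close>.\<close>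
      define e :: "'a mat" where "e = mat (Suc n) 1 (\<lambda>(k, _). if k = j then 1 else 0)"
      have e: "e \<in> carrier_mat (Suc n) 1" by (simp add: e_def)
      have "X $$ (i, j) = (\<Sum>k<Suc n. if k = j then X $$ (i, k) else 0)"
        using ij by simp
      also have "\<dots> = (\<Sum>k<Suc n. X $$ (i, k) * e $$ (k, 0))"
        by (intro sum.cong) (auto simp: e_def)
      also have "\<dots> = (X * e) $$ (i, 0)"
        using ij by (intro index_mult_mat_sum[OF X e, symmetric]) auto
      finally show "X $$ (i, j) = 0\<^sub>m (Suc m) (Suc n) $$ (i, j)"
        using ij by (simp add: Xw[OF e] del: index_mult_mat(1))
    qed (use X in auto)
    with X0 show False ..
  qed
  then have \<sigma>: "0 < \<sigma>" and \<sigma>2: "frob (X * v) (X * v) = \<sigma>\<^sup>2"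
    using frob_self_nonneg[of "X * v"] by (auto simp: \<sigma>_def)
  define u where "u = of_real (1 / \<sigma>) \<cdot>\<^sub>m (X * v)"
  have u: "u \<in> carrier_mat (Suc m) 1" using Xv by (simp add: u_def)
  have u1: "frob u u = 1"
    using \<sigma> unfolding u_def frob_smult_self \<sigma>2 by (simp add: power_divide)
  obtain V where V: "unitary_mat (Suc n) V" and V0: "\<And>i. i < Suc n \<Longrightarrow> V $$ (i, 0) = v $$ (i, 0)"
    using extend_unit_column[OF v v1] by blast
  obtain U where U: "unitary_mat (Suc m) U" and U0: "\<And>i. i < Suc m \<Longrightarrow> U $$ (i, 0) = u $$ (i, 0)"
    using extend_unit_column[OF u u1] by blast
  note uc = unitary_matD[OF U] and vc = unitary_matD[OF V]
  note ua = mat_adjoint_carrier[OF uc(1)] and va = mat_adjoint_carrier[OF vc(1)]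
  have XV: "X * V \<in> carrier_mat (Suc m) (Suc n)" using X vc(1) by auto
  define M where "M = mat_adjoint U * (X * V)"
  have M: "M \<in> carrier_mat (Suc m) (Suc n)" unfolding M_def using ua XV by (rule mult_carrier_mat)
  have X_eq: "X = U * M * mat_adjoint V"
  proof -
    have "U * M = X * V" unfolding M_def by (rule unitary_mat_adjoint_cancel[OF U XV])
    then show ?thesis
      using assoc_mult_mat[OF X vc(1) va] X by (simp add: vc(3))
  qed
  have col0: "M $$ (i, 0) = (if i = 0 then of_real \<sigma> else 0)" if i: "i < Suc m" for i
  proof -
    have XV0: "(X * V) $$ (k, 0) = of_real \<sigma> * U $$ (k, 0)" if k: "k < Suc m" for k
    proof -
      have "(X * V) $$ (k, 0) = (\<Sum>l<Suc n. X $$ (k, l) * V $$ (l, 0))"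
        using k by (intro index_mult_mat_sum[OF X vc(1)]) auto
      also have "\<dots> = (\<Sum>l<Suc n. X $$ (k, l) * v $$ (l, 0))"
        by (intro sum.cong) (auto simp: V0)
      also have "\<dots> = (X * v) $$ (k, 0)"
        using k by (intro index_mult_mat_sum[OF X v, symmetric]) auto
      also have "\<dots> = of_real \<sigma> * U $$ (k, 0)"
        using k \<sigma> X v by (simp add: U0 u_def del: index_mult_mat(1))
      finally show ?thesis .
    qed
    have "M $$ (i, 0) = (\<Sum>k<Suc m. mat_adjoint U $$ (i, k) * (X * V) $$ (k, 0))"
      unfolding M_def using i by (intro index_mult_mat_sum[OF ua XV]) auto
    also have "\<dots> = (\<Sum>k<Suc m. of_real \<sigma> * (mat_adjoint U $$ (i, k) * U $$ (k, 0)))"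
      by (intro sum.cong) (auto simp: XV0 simp del: index_mult_mat(1))
    also have "\<dots> = of_real \<sigma> * (mat_adjoint U * U) $$ (i, 0)"
      using i by (simp only: sum_distrib_left[symmetric] index_mult_mat_sum[OF ua uc(1) i zero_less_Suc])
    also have "\<dots> = (if i = 0 then of_real \<sigma> else 0)"
      using i by (simp add: uc(2))
    finally show ?thesis .
  qed
  have M_bound: "frob (M * w) (M * w) \<le> \<sigma>\<^sup>2 * frob w w" if w: "w \<in> carrier_mat (Suc n) 1" for w
  proof -
    have Vw: "V * w \<in> carrier_mat (Suc n) 1" using vc(1) w by (rule mult_carrier_mat)
    have "M * w = mat_adjoint U * (X * (V * w))"
      unfolding M_def assoc_mult_mat[OF ua XV w] assoc_mult_mat[OF X vc(1) w] ..
    then have "frob (M * w) (M * w) = frob (X * (V * w)) (X * (V * w))"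
      by (simp only: frob_unitary_left[OF unitary_mat_adjoint[OF U] mult_carrier_mat[OF X Vw] mult_carrier_mat[OF X Vw]])
    also have "\<dots> \<le> \<sigma>\<^sup>2 * frob (V * w) (V * w)" using max[OF Vw] by (simp only: \<sigma>2)
    also have "\<dots> = \<sigma>\<^sup>2 * frob w w" by (simp only: frob_unitary_left[OF V w w])
    finally show ?thesis .
  qed
  have row0: "M $$ (0, Suc j) = 0" if j: "j < n" for j
  proof -
    \<comment> \<open>The conjugated first row is the vector that the first row of \<open>M\<close> stretches most.\<close>
    define w where "w = mat (Suc n) 1 (\<lambda>(j, _). conjugate (M $$ (0, j)))"
    have w: "w \<in> carrier_mat (Suc n) 1" by (simp add: w_def)
    define \<rho> where "\<rho> = (\<Sum>j<Suc n. (norm (M $$ (0, j)))\<^sup>2)"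
    have fw: "frob w w = \<rho>" unfolding frob_self_column[OF w] by (simp add: w_def \<rho>_def del: sum.lessThan_Suc)
    have \<rho>_split: "\<rho> = \<sigma>\<^sup>2 + (\<Sum>j<n. (norm (M $$ (0, Suc j)))\<^sup>2)"
      unfolding \<rho>_def sum.lessThan_Suc_shift using \<sigma> by (simp add: col0)
    have "(M * w) $$ (0, 0) = (\<Sum>j<Suc n. M $$ (0, j) * w $$ (j, 0))"
      by (rule index_mult_mat_sum[OF M w]) auto
    also have "\<dots> = (\<Sum>j<Suc n. of_real ((norm (M $$ (0, j)))\<^sup>2))"
      by (intro sum.cong) (auto simp: w_def mult_conjugate)
    also have "\<dots> = of_real \<rho>" by (simp only: \<rho>_def of_real_sum)
    finally have Mw0: "(M * w) $$ (0, 0) = of_real \<rho>" .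
    have "(norm ((M * w) $$ (0, 0)))\<^sup>2 \<le> frob (M * w) (M * w)"
      unfolding frob_self_column[OF mult_carrier_mat[OF M w]]
      by (rule member_le_sum[where f = "\<lambda>i. (norm ((M * w) $$ (i, 0)))\<^sup>2"]) auto
    also have "\<dots> \<le> \<sigma>\<^sup>2 * \<rho>" using M_bound[OF w] by (simp only: fw)
    finally have "\<rho>\<^sup>2 \<le> \<sigma>\<^sup>2 * \<rho>" by (simp only: Mw0 norm_of_real power2_abs)
    moreover have "0 < \<rho>"
      unfolding \<rho>_split using \<sigma> by (intro add_pos_nonneg sum_nonneg) auto
    ultimately have "\<rho> \<le> \<sigma>\<^sup>2" by (simp add: power2_eq_square)
    then have "(\<Sum>j<n. (norm (M $$ (0, Suc j)))\<^sup>2) \<le> 0" by (simp add: \<rho>_split)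
    then have "(\<Sum>j<n. (norm (M $$ (0, Suc j)))\<^sup>2) = 0" by (intro antisym sum_nonneg) auto
    then show ?thesis using j by (subst (asm) sum_nonneg_eq_0_iff) auto
  qed
  define B where "B = mat m n (\<lambda>(i, j). M $$ (Suc i, Suc j))"
  have B: "B \<in> carrier_mat m n" by (simp add: B_def)
  have M_eq: "M = four_block_mat (mat 1 1 (\<lambda>_. of_real \<sigma>)) (0\<^sub>m 1 n) (0\<^sub>m m 1) B" (is "_ = ?F")
  proof (rule eq_matI)
    fix i j assume "i < dim_row ?F" "j < dim_col ?F"
    then have "i < Suc m" "j < Suc n" by (auto simp: B_def)
    then show "M $$ (i, j) = ?F $$ (i, j)"
      by (cases i; cases j) (auto simp: B_def col0 row0)
  qed (use M in \<open>auto simp: B_def\<close>)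
  show ?thesis
    by (rule that[OF U V less_imp_le[OF \<sigma>] B X_eq[unfolded M_eq]])
qed

text \<open>
  The block diagonal matrix \<open>diag(1, A)\<close>.
\<close>

definition bordered :: "'a :: conjugatable_field mat \<Rightarrow> 'a mat" where
  "bordered A = four_block_mat (1\<^sub>m 1) (0\<^sub>m 1 (dim_col A)) (0\<^sub>m (dim_row A) 1) A"

lemma mat_adjoint_bordered: "mat_adjoint (bordered A) = bordered (mat_adjoint (A :: 'a :: real_or_complex mat))"
  by (rule eq_matI) (auto simp: bordered_def)

lemma unitary_mat_bordered:
  fixes U :: "'a :: real_or_complex mat"
  assumes U: "unitary_mat k U"
  shows "unitary_mat (Suc k) (bordered U)"
proof -
  note u = unitary_matD[OF U]
  have dims: "dim_row U = k" "dim_col U = k" using u(1) by auto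
  have "bordered U * bordered (mat_adjoint U) = 1\<^sub>m (Suc k)"
    "bordered (mat_adjoint U) * bordered U = 1\<^sub>m (Suc k)"
    unfolding bordered_def using u(1)
    by (subst mult_four_block_mat[of _ 1 1 _ k _ k _ _ 1 _ k]; simp add: u dims)+
  moreover have "bordered U \<in> carrier_mat (Suc k) (Suc k)"
    using four_block_carrier_mat[OF one_carrier_mat[of 1] u(1)] by (simp add: bordered_def)
  ultimately show ?thesis by (simp add: unitary_mat_def mat_adjoint_bordered)
qed

lemma rect_diag_Suc:
  "rect_diag (Suc m) (Suc n) (case_nat \<sigma> s)
    = four_block_mat (mat 1 1 (\<lambda>_. of_real \<sigma>)) (0\<^sub>m 1 n) (0\<^sub>m m 1) (rect_diag m n s)"
  (is "?D = ?F")
proof (rule eq_matI)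
  fix i j assume "i < dim_row ?F" "j < dim_col ?F"
  then have "i < Suc m" "j < Suc n" by (auto simp: rect_diag_def)
  then show "?D $$ (i, j) = ?F $$ (i, j)"
    by (cases i; cases j) (auto simp: rect_diag_def)
qed (auto simp: rect_diag_def)

text \<open>
  A nonzero matrix is reduced by one row and one column to a smaller matrix, whose decomposition is
  then bordered. The recursion stops as soon as the matrix is zero, so that rank-deficient matrices
  and the two orientations of a rectangle need no separate treatment.
\<close>

lemma svd_exists:
  fixes X :: "'a :: real_or_complex mat"
  assumes "X \<in> carrier_mat m n"
  shows "\<exists>U s V. is_svd X U s V"
  using assms
proof (induction m arbitrary: n X)
  case (0 n X)
  have "X = 1\<^sub>m 0 * rect_diag 0 n (\<lambda>_. 0) * mat_adjoint (1\<^sub>m n)"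
    using 0 by (intro eq_matI) auto
  then have "is_svd X (1\<^sub>m 0) (\<lambda>_. 0) (1\<^sub>m n)"
    using 0 unitary_mat_1 by (auto simp: is_svd_def)
  then show ?case by blast
next
  case (Suc m n X)
  show ?case
  proof (cases "X = 0\<^sub>m (Suc m) n")
    case True
    have "rect_diag (Suc m) n (\<lambda>_. 0) = (0\<^sub>m (Suc m) n :: 'a mat)"
      by (rule eq_matI) (auto simp: rect_diag_def)
    then have "X = 1\<^sub>m (Suc m) * rect_diag (Suc m) n (\<lambda>_. 0) * mat_adjoint (1\<^sub>m n)"
      using True by simp
    then have "is_svd X (1\<^sub>m (Suc m)) (\<lambda>_. 0) (1\<^sub>m n)"
      using True unitary_mat_1 by (auto simp: is_svd_def)
    then show ?thesis by blast
  next
    case False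
    then obtain n' where n': "n = Suc n'"
      using Suc.prems by (cases n) (auto intro: eq_matI)
    obtain U V \<sigma> B where U: "unitary_mat (Suc m) U" and V: "unitary_mat (Suc n') V"
      and \<sigma>: "0 \<le> \<sigma>" and B: "B \<in> carrier_mat m n'"
      and X: "X = U * four_block_mat (mat 1 1 (\<lambda>_. of_real \<sigma>)) (0\<^sub>m 1 n') (0\<^sub>m m 1) B * mat_adjoint V"
      using split_off_singular_value[of X m n'] Suc.prems False unfolding n' by metis
    obtain U' s V' where svd: "is_svd B U' s V'" using Suc.IH[OF B] by blast
    have U': "unitary_mat m U'" and V': "unitary_mat n' V'"
      and s: "\<And>i. i < min m n' \<Longrightarrow> 0 \<le> s i"
      and B_eq: "B = U' * rect_diag m n' s * mat_adjoint V'"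
      using svd B by (auto simp: is_svd_def)
    note u = unitary_matD(1)[OF U] and v = unitary_matD(1)[OF V]
      and u' = unitary_matD(1)[OF U'] and v' = unitary_matD(1)[OF V']
    note bu = unitary_matD(1)[OF unitary_mat_bordered[OF U']]
      and bv = unitary_matD(1)[OF unitary_mat_bordered[OF V']]
    let ?S = "rect_diag (Suc m) (Suc n') (case_nat \<sigma> s) :: 'a mat"
    have S: "?S \<in> carrier_mat (Suc m) (Suc n')" by simp
    have block: "four_block_mat (mat 1 1 (\<lambda>_. of_real \<sigma>)) (0\<^sub>m 1 n') (0\<^sub>m m 1) B
        = bordered U' * ?S * mat_adjoint (bordered V')"
    proof -
      have R: "U' * rect_diag m n' s \<in> carrier_mat m n'" using u' by (rule mult_carrier_mat) simp
      have dims: "dim_row U' = m" "dim_col U' = m" "dim_row V' = n'" "dim_col V' = n'"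
        using u' v' by auto
      have "bordered U' * ?S = four_block_mat (mat 1 1 (\<lambda>_. of_real \<sigma>)) (0\<^sub>m 1 n') (0\<^sub>m m 1)
          (U' * rect_diag m n' s)"
        unfolding bordered_def rect_diag_Suc dims using u' R
        by (subst mult_four_block_mat[of _ 1 1 _ m _ m _ _ 1 _ n'])
          (auto simp: left_mult_zero_mat[OF rect_diag_carrier])
      moreover have "\<dots> * bordered (mat_adjoint V')
        = four_block_mat (mat 1 1 (\<lambda>_. of_real \<sigma>)) (0\<^sub>m 1 n') (0\<^sub>m m 1) B"
        unfolding bordered_def dim_mat_adjoint dims B_eq using mat_adjoint_carrier[OF v'] R
        by (subst mult_four_block_mat[of _ 1 1 _ n' _ m _ _ 1 _ n'])
          (auto simp: right_mult_zero_mat[OF R] left_mult_zero_mat[OF mat_adjoint_carrier[OF v']])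
      ultimately show ?thesis by (simp only: mat_adjoint_bordered)
    qed
    have bUS: "bordered U' * ?S \<in> carrier_mat (Suc m) (Suc n')" using bu S by (rule mult_carrier_mat)
    have UbUS: "U * (bordered U' * ?S) \<in> carrier_mat (Suc m) (Suc n')" using u bUS by (rule mult_carrier_mat)
    have "X = U * (bordered U' * ?S * mat_adjoint (bordered V')) * mat_adjoint V"
      unfolding X block ..
    also have "\<dots> = U * (bordered U' * ?S) * mat_adjoint (bordered V') * mat_adjoint V"
      by (simp only: assoc_mult_mat[OF u bUS mat_adjoint_carrier[OF bv]])
    also have "\<dots> = U * (bordered U' * ?S) * (mat_adjoint (bordered V') * mat_adjoint V)"
      by (rule assoc_mult_mat[OF UbUS mat_adjoint_carrier[OF bv] mat_adjoint_carrier[OF v]])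
    also have "\<dots> = (U * bordered U') * ?S * mat_adjoint (V * bordered V')"
      by (simp only: assoc_mult_mat[OF u bu S] mat_adjoint_mult[OF v bv])
    finally have "X = U * bordered U' * ?S * mat_adjoint (V * bordered V')" .
    moreover have "dim_row X = Suc m" "dim_col X = Suc n'" using Suc.prems n' by auto
    moreover have "\<forall>i < min (Suc m) (Suc n'). 0 \<le> case_nat \<sigma> s i"
      using \<sigma> s by (auto split: nat.split)
    ultimately have "is_svd X (U * bordered U') (case_nat \<sigma> s) (V * bordered V')"
      unfolding is_svd_def using unitary_mat_mult[OF U unitary_mat_bordered[OF U']]
        unitary_mat_mult[OF V unitary_mat_bordered[OF V']] by metis
    then show ?thesis by blast
  qed
qed

section \<open>The projection inequality and the clipping map\<close>

text \<open>
  The entry is \<open>\<Sum>\<^sub>l t\<^sub>l P\<^sub>i\<^sub>l conj(Q\<^sub>i\<^sub>l)\<close>. By \<open>2ab \<le> a\<^sup>2 + b\<^sup>2\<close> each term is at most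
  \<open>c / 2\<close> times the sum of the squared norms of the two factors, and rows of unitary matrices have norm one.
\<close>

lemma re_part_diag_entry_le:
  fixes P Q :: "'a :: real_or_complex mat"
  assumes P: "unitary_mat m P" and Q: "unitary_mat n Q"
    and t: "\<And>i. i < min m n \<Longrightarrow> 0 \<le> t i \<and> t i \<le> c" and c: "0 \<le> c"
    and i: "i < m" "i < n"
  shows "re_part ((P * rect_diag m n t * mat_adjoint Q) $$ (i, i)) \<le> c"
proof -
  note p = unitary_matD(1)[OF P] and q = unitary_matD(1)[OF Q]
  let ?D = "rect_diag m n t :: 'a mat"
  have PD: "(P * ?D) $$ (i, l) = (if l < m then P $$ (i, l) * of_real (t l) else 0)" if "l < n" for l
  proof -
    have "(P * ?D) $$ (i, l) = (\<Sum>k<m. P $$ (i, k) * ?D $$ (k, l))"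
      using i that by (intro index_mult_mat_sum[OF p]) auto
    also have "\<dots> = (\<Sum>k<m. if k = l then P $$ (i, k) * of_real (t k) else 0)"
      using that by (intro sum.cong) auto
    finally show ?thesis by simp
  qed
  have "(P * ?D * mat_adjoint Q) $$ (i, i) = (\<Sum>l<n. (P * ?D) $$ (i, l) * mat_adjoint Q $$ (l, i))"
    using p q i by (intro index_mult_mat_sum[of _ m n _ n]) (auto intro: mult_carrier_mat[where n = m])
  then have "re_part ((P * ?D * mat_adjoint Q) $$ (i, i))
      = (\<Sum>l<n. re_part ((P * ?D) $$ (i, l) * mat_adjoint Q $$ (l, i)))"
    by (simp add: re_part_sum)
  also have "\<dots> \<le> (\<Sum>l<n. c / 2 * ((if l < m then (norm (P $$ (i, l)))\<^sup>2 else 0) + (norm (Q $$ (i, l)))\<^sup>2))"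
  proof (rule sum_mono)
    fix l assume l: "l \<in> {..<n}"
    show "re_part ((P * ?D) $$ (i, l) * mat_adjoint Q $$ (l, i))
      \<le> c / 2 * ((if l < m then (norm (P $$ (i, l)))\<^sup>2 else 0) + (norm (Q $$ (i, l)))\<^sup>2)"
    proof (cases "l < m")
      case True
      let ?a = "norm (P $$ (i, l))" and ?b = "norm (Q $$ (i, l))"
      have tl: "0 \<le> t l" "t l \<le> c" using t[of l] True l by auto
      have "re_part ((P * ?D) $$ (i, l) * mat_adjoint Q $$ (l, i))
          \<le> norm ((P * ?D) $$ (i, l) * mat_adjoint Q $$ (l, i))"
        by (rule re_part_le_norm)
      also have "\<dots> = t l * (?a * ?b)"
        using True l i q tl by (simp add: PD norm_mult del: index_mult_mat(1))
      also have "\<dots> \<le> c * (?a * ?b)"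
        using tl by (intro mult_right_mono) auto
      also have "\<dots> \<le> c * ((?a\<^sup>2 + ?b\<^sup>2) / 2)"
        using c sum_squares_bound[of ?a ?b] by (intro mult_left_mono) auto
      finally show ?thesis using True by simp
    next
      case False
      then show ?thesis using l c by (simp add: PD del: index_mult_mat(1))
    qed
  qed
  also have "\<dots> = c / 2 * ((\<Sum>l<n. if l < m then (norm (P $$ (i, l)))\<^sup>2 else 0) + 1)"
    by (simp only: sum_distrib_left[symmetric] sum.distrib sum_norm_row_unitary[OF Q i(2)])
  also have "\<dots> \<le> c / 2 * (1 + 1)"
  proof -
    have "(\<Sum>l<n. if l < m then (norm (P $$ (i, l)))\<^sup>2 else 0)
        = (\<Sum>l\<in>{..<n} \<inter> {..<m}. (norm (P $$ (i, l)))\<^sup>2)"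
      by (simp add: sum.inter_restrict)
    also have "\<dots> \<le> (\<Sum>l<m. (norm (P $$ (i, l)))\<^sup>2)"
      by (rule sum_mono2) auto
    also have "\<dots> = 1" by (rule sum_norm_row_unitary[OF P i(1)])
    finally show ?thesis using c by (intro mult_left_mono) auto
  qed
  finally show ?thesis by simp
qed

lemma frob_rect_diag_right:
  fixes W :: "'a :: real_or_complex mat"
  assumes W: "W \<in> carrier_mat m n"
  shows "frob W (rect_diag m n d) = (\<Sum>i<min m n. re_part (W $$ (i, i)) * d i)"
proof -
  have "frob W (rect_diag m n d)
      = (\<Sum>j<n. \<Sum>i<m. if i = j then re_part (W $$ (i, i)) * d i else 0)"
    unfolding frob_eq_sum[OF W rect_diag_carrier]
    by (intro sum.cong refl) (auto simp: mult.commute[of "conjugate _" "of_real _"])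
  also have "\<dots> = (\<Sum>j<n. if j < m then re_part (W $$ (j, j)) * d j else 0)"
    by (intro sum.cong refl) simp
  also have "\<dots> = (\<Sum>j\<in>{..<n} \<inter> {..<m}. re_part (W $$ (j, j)) * d j)"
    by (simp add: sum.inter_restrict)
  also have "{..<n} \<inter> {..<m} = {..<min m n}" by auto
  finally show ?thesis .
qed

text \<open>
  The projection inequality. The matrix \<open>Y\<close> enters only through a decomposition with singular values
  at most \<open>c\<close>; in the bases \<open>U\<close>, \<open>V\<close> of \<open>X\<close> it becomes \<open>W = P T Q\<^sup>*\<close> with \<open>P\<close>, \<open>Q\<close> unitary again.
\<close>

lemma frob_clip_nonneg:
  fixes U V U' V' :: "'a :: real_or_complex mat"
  assumes c: "0 \<le> c"
    and U: "unitary_mat m U" and V: "unitary_mat n V"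
    and X: "X = U * rect_diag m n s * mat_adjoint V"
    and Z: "Z = U * rect_diag m n (\<lambda>i. min (s i) c) * mat_adjoint V"
    and U': "unitary_mat m U'" and V': "unitary_mat n V'"
    and t: "\<And>i. i < min m n \<Longrightarrow> 0 \<le> t i \<and> t i \<le> c"
    and Y: "Y = U' * rect_diag m n t * mat_adjoint V'"
  shows "0 \<le> frob (Z - Y) (X - Z)"
proof -
  let ?D = "\<lambda>s. rect_diag m n s :: 'a mat"
  note car = unitary_matD(1)[OF U] unitary_matD(1)[OF V] unitary_matD(1)[OF U'] unitary_matD(1)[OF V']
  note [simp] = car mat_adjoint_carrier[OF car(1)] mat_adjoint_carrier[OF car(2)]
    mat_adjoint_carrier[OF car(3)] mat_adjoint_carrier[OF car(4)]
  define P where "P = mat_adjoint U * U'"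
  define Q where "Q = mat_adjoint V * V'"
  have P: "unitary_mat m P" and Q: "unitary_mat n Q"
    unfolding P_def Q_def by (simp_all add: unitary_mat_mult unitary_mat_adjoint U V U' V')
  note [simp] = unitary_matD(1)[OF P] unitary_matD(1)[OF Q] mat_adjoint_carrier[OF unitary_matD(1)[OF Q]]
  define W where "W = P * ?D t * mat_adjoint Q"
  have W: "W \<in> carrier_mat m n" unfolding W_def
    by (intro mult_carrier_mat[where n = n] mult_carrier_mat[where n = m]) auto
  have YW: "Y = U * W * mat_adjoint V"
  proof -
    have PU: "U * P = U'"
      unfolding P_def by (rule unitary_mat_adjoint_cancel[OF U car(3)])
    have QV: "V * Q = V'"
      unfolding Q_def by (rule unitary_mat_adjoint_cancel[OF V car(4)])
    have "Y = (U * P) * ?D t * (mat_adjoint Q * mat_adjoint V)"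
      unfolding PU Y by (simp add: mat_adjoint_mult[symmetric, of _ n n _ n] QV)
    also have "\<dots> = ((U * P) * ?D t) * mat_adjoint Q * mat_adjoint V"
      by (rule assoc_mult_mat[symmetric, of _ m n _ n _ n])
        (auto intro!: mult_carrier_mat[where n = m])
    also have "(U * P) * ?D t = U * (P * ?D t)"
      by (rule assoc_mult_mat[of _ m m _ m _ n]) auto
    also have "U * (P * ?D t) * mat_adjoint Q = U * W"
      unfolding W_def
      by (rule assoc_mult_mat[of _ m m _ n _ n]) (auto intro: mult_carrier_mat[where n = m])
    finally show ?thesis .
  qed
  have diff: "U * A * mat_adjoint V - U * B * mat_adjoint V = U * (A - B) * mat_adjoint V"
    if "A \<in> carrier_mat m n" "B \<in> carrier_mat m n" for A B
    using that
    by (subst mult_minus_distrib_mat[of _ m m _ n], simp_all,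
        subst minus_mult_distrib_mat[of _ m n _ _ n], auto intro: mult_carrier_mat[where n = m])
  let ?s' = "\<lambda>i. min (s i) c"
  have "frob (Z - Y) (X - Z)
      = frob (U * (?D ?s' - W) * mat_adjoint V) (U * (?D s - ?D ?s') * mat_adjoint V)"
    unfolding Z X YW by (simp add: diff W)
  also have "\<dots> = frob (?D ?s' - W) (?D s - ?D ?s')"
    using W by (subst frob_unitary_right[OF V, where m = m],
        simp_all add: mult_carrier_mat[where n = m] minus_carrier_mat frob_unitary_left[OF U, where n = n])
  also have "?D s - ?D ?s' = ?D (\<lambda>i. s i - ?s' i)"
    by (rule eq_matI) (auto simp: rect_diag_def)
  also have "frob (?D ?s' - W) \<dots> = (\<Sum>i<min m n. (?s' i - re_part (W $$ (i, i))) * (s i - ?s' i))"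
    using W by (subst frob_rect_diag_right) (auto intro!: minus_carrier_mat sum.cong)
  also have "\<dots> \<ge> 0"
  proof (rule sum_nonneg)
    fix i assume i: "i \<in> {..<min m n}"
    have "re_part (W $$ (i, i)) \<le> c"
      unfolding W_def using i by (intro re_part_diag_entry_le[OF P Q t c]) auto
    \<comment> \<open>Either nothing is clipped and the second factor vanishes, or the clipped value is \<open>c\<close>.\<close>
    then show "0 \<le> (?s' i - re_part (W $$ (i, i))) * (s i - ?s' i)"
      by (cases "s i \<le> c") auto
  qed
  finally show ?thesis .
qed

text \<open>
  Projections are unique: the projection inequality, applied in both directions to two candidate
  clippings, forces their difference to have norm zero.
\<close>

lemma sv_clip_eqI:
  fixes X :: "'a :: real_or_complex mat"
  assumes c: "0 \<le> c" and svd: "is_svd X U s V"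
  shows "sv_clip c X = U * rect_diag (dim_row X) (dim_col X) (\<lambda>i. min (s i) c) * mat_adjoint V"
proof -
  let ?m = "dim_row X" and ?n = "dim_col X"
  let ?clip = "\<lambda>U s V. U * rect_diag ?m ?n (\<lambda>i. min (s i) c) * mat_adjoint V"
  have unique: "?clip U' s' V' = ?clip U s V" if svd': "is_svd X U' s' V'" for U' s' V'
  proof -
    define Z where "Z = ?clip U s V"
    define Z' where "Z' = ?clip U' s' V'"
    note d = svd[unfolded is_svd_def] and d' = svd'[unfolded is_svd_def]
    have Z: "Z \<in> carrier_mat ?m ?n" and Z': "Z' \<in> carrier_mat ?m ?n"
      using d d' by (auto simp: unitary_mat_def Z_def Z'_def rect_diag_def)
    have X: "X \<in> carrier_mat ?m ?n" by simp
    have "0 \<le> frob (Z - Z') (X - Z)"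
      using d d' c by (intro frob_clip_nonneg[OF c _ _ _ Z_def _ _ _ Z'_def]) auto
    moreover have "0 \<le> frob (Z' - Z) (X - Z')"
      using d d' c by (intro frob_clip_nonneg[OF c _ _ _ Z'_def _ _ _ Z_def]) auto
    ultimately have "frob (Z - Z') (Z - Z') \<le> 0"
      by (simp add: frob_diff_left[of _ ?m ?n] frob_diff_right[of _ ?m ?n] Z Z' minus_carrier_mat)
    then have "frob (Z - Z') (Z - Z') = 0"
      using frob_self_nonneg[of "Z - Z'"] by simp
    from frob_self_eq_0D[OF minus_carrier_mat[OF Z'] this] have 0: "Z - Z' = 0\<^sub>m ?m ?n" .
    have "Z' = Z"
    proof (rule eq_matI)
      fix i j assume "i < dim_row Z" "j < dim_col Z"
      then have "0\<^sub>m ?m ?n $$ (i, j) = (0 :: 'a)" "(Z - Z') $$ (i, j) = Z $$ (i, j) - Z' $$ (i, j)"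
        using Z Z' by auto
      then show "Z' $$ (i, j) = Z $$ (i, j)" by (simp add: 0)
    qed (use Z Z' in auto)
    then show ?thesis by (simp add: Z_def Z'_def)
  qed
  show ?thesis
    unfolding sv_clip_def using svd unique by (intro the_equality) blast+
qed

lemma frob_sv_clip_nonneg:
  fixes X Y :: "'a :: real_or_complex mat"
  assumes c: "0 \<le> c" and X: "X \<in> carrier_mat m n" and Y: "Y \<in> carrier_mat m n"
    and fixed: "Y = sv_clip c Y"
  shows "0 \<le> frob (X - Y) (X - sv_clip c X)"
proof -
  obtain U s V where svd: "is_svd X U s V" using svd_exists[OF X] by blast
  obtain U' s' V' where svd': "is_svd Y U' s' V'" using svd_exists[OF Y] by blast
  define Z where "Z = sv_clip c X"
  have Z_eq: "Z = U * rect_diag m n (\<lambda>i. min (s i) c) * mat_adjoint V"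
    unfolding Z_def sv_clip_eqI[OF c svd] using X by simp
  have Y_eq: "Y = U' * rect_diag m n (\<lambda>i. min (s' i) c) * mat_adjoint V'"
    using fixed sv_clip_eqI[OF c svd'] Y by simp
  note d = svd[unfolded is_svd_def] and d' = svd'[unfolded is_svd_def]
  have Z: "Z \<in> carrier_mat m n"
    using d X by (auto simp: unitary_mat_def Z_eq rect_diag_def)
  have "0 \<le> frob (Z - Y) (X - Z)"
    using d d' X Y c by (intro frob_clip_nonneg[OF c _ _ _ Z_eq _ _ _ Y_eq]) auto
  moreover have "frob (X - Y) (X - Z) = frob (X - Z) (X - Z) + frob (Z - Y) (X - Z)"
    using X Y Z by (simp add: frob_diff_left[of _ m n] minus_carrier_mat)
  ultimately show ?thesis
    using frob_self_nonneg[of "X - Z"] by (simp add: Z_def)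
qed

theorem mainTheorem1:
  fixes c :: real and m n :: nat
  assumes "0 \<le> c" and "0 < m" and "0 < n"
  shows "(\<forall>X \<in> carrier_mat m n. \<forall>Y \<in> carrier_mat m n. Y = sv_clip c Y \<longrightarrow>
            frob_inner_real (X - Y) (X - sv_clip c X) \<ge> 0) \<and>
         (\<forall>X \<in> carrier_mat m n. \<forall>Y \<in> carrier_mat m n. Y = sv_clip c Y \<longrightarrow>
            frob_inner_complex (X - Y) (X - sv_clip c X) \<ge> 0)"
  using frob_sv_clip_nonneg[OF assms(1), where 'a = real]
    frob_sv_clip_nonneg[OF assms(1), where 'a = complex]
  unfolding frob_inner_real_eq frob_inner_complex_eq by blast

end
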